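(* Let $d\in\mathbb{N}$ and $1<p<\infty$. There exists $K>0$ such that for all $x\in\mathbb{R}^{\mathbb{Z}^d}$ and each positive $\phi\in\mathbb{R}^{\mathbb{Z}^d}$ the following three inequalities hold: (1) $\sum_{k\in\mathbb{Z}^d}\bigl(Mx(k)\bigr)^p\phi(k)\leq K\sum_{k\in\mathbb{Z}^d}|x(k)|^{p}M\phi(k)$, (2) $\sum_{k\in\mathbb{Z}^d}\bigl(\hat{M}x(k)\bigr)^p\phi(k)\leq K\sum_{k\in\mathbb{Z}^d}|x(k)|^{p}\hat{M}\phi(k)$, and (3) $\sum_{k\in\mathbb{Z}^d}\bigl(\tilde{M}x(k)\bigr)^p\phi(k)\leq K\sum_{k\in\mathbb{Z}^d}|x(k)|^{p}\tilde{M}\phi(k)$.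
   Context: $\mathbb{N}=\{1,2,3,\dots\}$ and $\omega:=\mathbb{N}\cup\{0\}$. $\mathbb{R}^{\mathbb{Z}^d}$ is the set of all functions $\mathbb{Z}^d\to\mathbb{R}$; such a function $\phi$ is called positive if $\phi(k)\geq 0$ for each $k\in\mathbb{Z}^d$. $\|(x_1,\dots,x_d)\|_\infty:=\max\{|x_i|:1\le i\le d\}$, and $|S|$ denotes the cardinality of a set $S$. For $m\in\mathbb{Z}^d$ and $N\in\omega$ let $S_{m,N}:=\{k\in\mathbb{Z}^d:\|k-m\|_\infty\leq N\}$, so $|S_{m,N}|=(2N+1)^d$. For $m=(m_1,\dots,m_d)\in\mathbb{Z}^d$ and $N\in\mathbb{N}$ let $R_{m,N}:=S_{m,N}\setminus\{(k_1,\dots,k_d)\in\mathbb{Z}^d: k_i=m_i+N \text{ for some } 1\leq i\leq d\}$, so $|R_{m,N}|=(2N)^d$. For $x\in\mathbb{R}^{\mathbb{Z}^d}$ and $m\in\mathbb{Z}^d$ define the ("odd") discrete Hardy-Littlewood maximal operator $Mx(m):=\sup_{N\in\omega}\frac{1}{|S_{m,N}|}\sum_{k\in S_{m,N}}|x(k)|$; the "even" discrete Hardy-Littlewood maximal operator $\hat{M}x(m):=\sup_{N\in\mathbb{N}}\frac{1}{|R_{m,N}|}\sum_{k\in R_{m,N}}|x(k)|$; the "uncentered" discrete Hardy-Littlewood maximal operator $\tilde{M}x(m):=\sup_{S\ni m}\frac{1}{|S|}\sum_{k\in S}|x(k)|$, the supremum being over all sets of the form $S=S_{k,N}$ (for some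 $k\in\mathbb{Z}^d$, $N\in\omega$) that contain $m$. These suprema and the sums in the claim take values in $[0,\infty]$, with the convention $0\cdot\infty=0$. *)

theory Defs
  imports "HOL-Analysis.Analysis"
begin

definition sup_norm :: "int ^ 'd \<Rightarrow> int" where
  "sup_norm x = Max (range (\<lambda>i. \<bar>x $ i\<bar>))"

definition cube :: "int ^ 'd \<Rightarrow> nat \<Rightarrow> (int ^ 'd) set" where
  "cube m N = {k. sup_norm (k - m) \<le> int N}"

definition half_open_cube :: "int ^ 'd \<Rightarrow> nat \<Rightarrow> (int ^ 'd) set" where
  "half_open_cube m N = cube m N - {k. \<exists>i. k $ i = m $ i + int N}"

definition average_abs :: "(int ^ 'd \<Rightarrow> real) \<Rightarrow> (int ^ 'd) set \<Rightarrow> real" where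
  "average_abs x S = (\<Sum>k\<in>S. \<bar>x k\<bar>) / real (card S)"

definition maximal_odd :: "(int ^ 'd \<Rightarrow> real) \<Rightarrow> int ^ 'd \<Rightarrow> ennreal" where
  "maximal_odd x m = (SUP N. ennreal (average_abs x (cube m N)))"

definition maximal_even :: "(int ^ 'd \<Rightarrow> real) \<Rightarrow> int ^ 'd \<Rightarrow> ennreal" where
  "maximal_even x m = (SUP N\<in>{1..}. ennreal (average_abs x (half_open_cube m N)))"

definition maximal_uncentered :: "(int ^ 'd \<Rightarrow> real) \<Rightarrow> int ^ 'd \<Rightarrow> ennreal" where
  "maximal_uncentered x m =
     (SUP S\<in>{cube k N | k N. m \<in> cube k N}. ennreal (average_abs x S))"

text \<open>
  Real powers on \<open>[0, \<infinity>]\<close>, intended for exponents \<open>p > 0\<close> only: there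
  \<open>0\<close> is sent to \<open>0\<close> and \<open>\<infinity>\<close> to \<open>\<infinity>\<close>.
\<close>
definition ennreal_powr :: "ennreal \<Rightarrow> real \<Rightarrow> ennreal" where
  "ennreal_powr a p = (if a = \<infinity> then \<infinity> else ennreal (enn2real a powr p))"

lemma mem_cube_iff: "k \<in> cube m N \<longleftrightarrow> (\<forall>i. k $ i \<in> {m $ i - int N .. m $ i + int N})"
proof -
  have "sup_norm (k - m) \<le> int N \<longleftrightarrow> (\<forall>i. \<bar>k $ i - m $ i\<bar> \<le> int N)"
    unfolding sup_norm_def by (subst Max_le_iff) auto
  also have "\<dots> \<longleftrightarrow> (\<forall>i. k $ i \<in> {m $ i - int N .. m $ i + int N})"
    by (intro iff_allI) auto
  finally show ?thesis
    by (simp add: cube_def)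
qed

lemma mem_half_open_cube_iff:
  "k \<in> half_open_cube m N \<longleftrightarrow> (\<forall>i. k $ i \<in> {m $ i - int N ..< m $ i + int N})"
  unfolding half_open_cube_def Diff_iff mem_cube_iff mem_Collect_eq atLeastAtMost_iff atLeastLessThan_iff order_less_le
  by metis

lemma vec_box_card:
  fixes A :: "'d::finite \<Rightarrow> int set" and n :: nat
  assumes "\<And>i. finite (A i)" "\<And>i. card (A i) = n"
  shows "finite {k :: int ^ 'd. \<forall>i. k $ i \<in> A i}"
    and "card {k :: int ^ 'd. \<forall>i. k $ i \<in> A i} = n ^ CARD('d)"
proof -
  have eq: "{k :: int ^ 'd. \<forall>i. k $ i \<in> A i} = vec_lambda ` (PiE UNIV A)"
  proof (intro equalityI subsetI)
    fix k :: "int ^ 'd" assume "k \<in> {k. \<forall>i. k $ i \<in> A i}"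
    then show "k \<in> vec_lambda ` (PiE UNIV A)"
      by (intro image_eqI[where x = "vec_nth k"]) auto
  qed auto
  show "finite {k :: int ^ 'd. \<forall>i. k $ i \<in> A i}"
    unfolding eq by (intro finite_imageI finite_PiE) (auto simp: assms)
  have "inj_on vec_lambda (PiE UNIV A)"
    by (auto intro!: inj_onI simp: vec_lambda_inject)
  then show "card {k :: int ^ 'd. \<forall>i. k $ i \<in> A i} = n ^ CARD('d)"
    unfolding eq by (simp add: card_image card_PiE assms)
qed

lemma
  fixes m :: "int ^ 'd"
  shows finite_cube: "finite (cube m N)"
    and card_cube: "card (cube m N) = (2 * N + 1) ^ CARD('d)"
proof -
  have "cube m N = {k. \<forall>i. k $ i \<in> {m $ i - int N .. m $ i + int N}}"
    by (simp only: set_eq_iff mem_cube_iff mem_Collect_eq simp_thms)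
  moreover have "card {m $ i - int N .. m $ i + int N} = 2 * N + 1" for i
    by simp
  ultimately show "finite (cube m N)" "card (cube m N) = (2 * N + 1) ^ CARD('d)"
    using vec_box_card[where A = "\<lambda>i. {m $ i - int N .. m $ i + int N}" and n = "2 * N + 1"]
    by simp_all
qed

lemma
  fixes m :: "int ^ 'd"
  shows finite_half_open_cube: "finite (half_open_cube m N)"
    and card_half_open_cube: "card (half_open_cube m N) = (2 * N) ^ CARD('d)"
proof -
  have "half_open_cube m N = {k. \<forall>i. k $ i \<in> {m $ i - int N ..< m $ i + int N}}"
    by (simp only: set_eq_iff mem_half_open_cube_iff mem_Collect_eq simp_thms)
  moreover have "card {m $ i - int N ..< m $ i + int N} = 2 * N" for i
    by simp
  ultimately show "finite (half_open_cube m N)" "card (half_open_cube m N) = (2 * N) ^ CARD('d)"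
    using vec_box_card[where A = "\<lambda>i. {m $ i - int N ..< m $ i + int N}" and n = "2 * N"]
    by simp_all
qed

end

theory Submission
  imports Defs
begin

text \<open>
  The three operators are handled at once. By Vitali's covering argument, the points where
  the maximal function of \<open>x\<close> exceeds \<open>t\<close> are covered by enlargements of finitely many disjoint
  balls on which \<open>x\<close> has average above \<open>t\<close>; since an enlarged ball lies in a comparable ball
  attached to each point of the original one, the \<open>\<phi>\<close>-mass of the enlargement is controlled by the
  maximal function of \<open>\<phi>\<close> at all those points. Discarding the values of \<open>x\<close> below \<open>t / 2\<close> costs
  only a factor \<open>2\<close> in this weak-type bound, which can then be integrated against
  \<open>p * t powr (p - 1)\<close>.
\<close>

section \<open>Sums and integrals with values in \<open>[0, \<infinity>]\<close>\<close>

text \<open>Monotone convergence along the finite sets \<open>A n\<close> exhausting the countable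
  type. This is the way back from integrals over counting measure, where Tonelli is available, to
  the sums of the theorem.\<close>

lemma nn_integral_count_space_le_infsum:
  fixes f :: "'a::countable \<Rightarrow> ennreal"
  shows "(\<integral>\<^sup>+k. f k \<partial>count_space UNIV) \<le> (\<Sum>\<^sub>\<infinity>k. f k)"
proof -
  define A where "A n = {k::'a. to_nat k < n}" for n
  have fin: "finite (A n)" for n
    unfolding A_def by (rule inj_on_finite[of to_nat _ "{..<n}"]) auto
  have "f k = (SUP n. f k * indicator (A n) k)" for k
  proof (rule antisym)
    have "f k = f k * indicator (A (Suc (to_nat k))) k"
      by (simp add: A_def)
    also have "\<dots> \<le> (SUP n. f k * indicator (A n) k)"
      by (rule SUP_upper) simp
    finally show "f k \<le> (SUP n. f k * indicator (A n) k)" .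
    show "(SUP n. f k * indicator (A n) k) \<le> f k"
      by (rule SUP_least) (simp split: split_indicator)
  qed
  then have "(\<integral>\<^sup>+k. f k \<partial>count_space UNIV)
      = (\<integral>\<^sup>+k. (SUP n. f k * indicator (A n) k) \<partial>count_space UNIV)"
    by simp
  also have "\<dots> = (SUP n. \<integral>\<^sup>+k. f k * indicator (A n) k \<partial>count_space UNIV)"
    by (rule nn_integral_monotone_convergence_SUP)
      (auto simp: incseq_def le_fun_def A_def split: split_indicator)
  also have "\<dots> \<le> (\<Sum>\<^sub>\<infinity>k. f k)"
  proof (rule SUP_least)
    fix n
    have "(\<integral>\<^sup>+k. f k * indicator (A n) k \<partial>count_space UNIV) = (\<Sum>k\<in>A n. f k)"
      using fin by (simp add: nn_integral_count_space_indicator[symmetric] nn_integral_count_space_finite)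
    also have "\<dots> \<le> (\<Sum>\<^sub>\<infinity>k. f k)"
      using fin by (subst nonneg_infsum_complete) (auto intro!: SUP_upper)
    finally show "(\<integral>\<^sup>+k. f k * indicator (A n) k \<partial>count_space UNIV) \<le> (\<Sum>\<^sub>\<infinity>k. f k)" .
  qed
  finally show ?thesis .
qed

lemma sum_UNION_le:
  fixes f :: "'a \<Rightarrow> real"
  assumes "finite J" "\<And>i. i \<in> J \<Longrightarrow> finite (A i)" "\<And>x. f x \<ge> 0"
  shows "sum f (\<Union>i\<in>J. A i) \<le> (\<Sum>i\<in>J. sum f (A i))"
  using assms(1,2)
proof (induction J rule: finite_induct)
  case (insert i J)
  have "sum f (A i \<union> (\<Union>i\<in>J. A i)) \<le> sum f (A i) + sum f (\<Union>i\<in>J. A i)"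
    using insert.hyps insert.prems assms(3) by (subst sum_Un) (auto intro!: sum_nonneg)
  with insert show ?case by fastforce
qed simp

lemma nn_integral_powr_from_0:
  assumes "a > -1" "c \<ge> (0::real)"
  shows "(\<integral>\<^sup>+t. ennreal (t powr a) * indicator {0..c} t \<partial>lborel) = ennreal (c powr (a + 1) / (a + 1))"
  by (rule nn_integral_has_integral_lebesgue'[OF _ has_integral_powr_from_0]) (use assms in auto)

text \<open>For finite \<open>c \<le> a\<close>, \<open>c powr p\<close> is the integral of
  \<open>p * t powr (p - 1)\<close> over \<open>{0..c}\<close>, where \<open>ennreal t < a\<close>
  for almost all \<open>t\<close>. Finite \<open>a\<close> is its own \<open>c\<close>; for infinite
  \<open>a\<close>, arbitrarily large \<open>c\<close> show that the integral is infinite.\<close>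

lemma ennreal_powr_layer_cake:
  assumes "p > 0"
  shows "ennreal_powr a p
    \<le> (\<integral>\<^sup>+t. ennreal (p * t powr (p - 1)) * of_bool (0 < t \<and> ennreal t < a) \<partial>lborel)"
proof -
  have fin: "ennreal (c powr p)
      \<le> (\<integral>\<^sup>+t. ennreal (p * t powr (p - 1)) * of_bool (0 < t \<and> ennreal t < a) \<partial>lborel)"
    if c: "c \<ge> 0" "ennreal c \<le> a" for c
  proof -
    have "ennreal (c powr p) = ennreal p * ennreal (c powr (p - 1 + 1) / (p - 1 + 1))"
      using assms by (simp flip: ennreal_mult)
    also have "\<dots> = ennreal p * (\<integral>\<^sup>+t. ennreal (t powr (p - 1)) * indicator {0..c} t \<partial>lborel)"
      by (subst nn_integral_powr_from_0) (use assms c in auto)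
    also have "\<dots> = (\<integral>\<^sup>+t. ennreal p * (ennreal (t powr (p - 1)) * indicator {0..c} t) \<partial>lborel)"
      by (rule nn_integral_cmult[symmetric]) simp
    also have "\<dots> \<le> (\<integral>\<^sup>+t. ennreal (p * t powr (p - 1)) * of_bool (0 < t \<and> ennreal t < a) \<partial>lborel)"
    proof (rule nn_integral_mono_AE)
      \<comment> \<open>If \<open>ennreal c = a\<close>, the strict condition
        \<open>ennreal t < a\<close> fails at \<open>t = c\<close>, which is a null set.\<close>
      have "AE t in lborel. t \<noteq> c" by (rule AE_lborel_singleton)
      then show "AE t in lborel. ennreal p * (ennreal (t powr (p - 1)) * indicator {0..c} t)
          \<le> ennreal (p * t powr (p - 1)) * of_bool (0 < t \<and> ennreal t < a)"
      proof eventually_elim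
        case (elim t)
        show ?case
        proof (cases "0 < t \<and> t < c")
          case True
          then have "ennreal t < ennreal c" by (simp add: ennreal_less_iff)
          with c have "ennreal t < a" by (rule_tac order.strict_trans2)
          then show ?thesis using True assms by (simp add: ennreal_mult)
        next
          case False
          \<comment> \<open>The endpoint \<open>t = 0\<close> lies in \<open>{0..c}\<close>, but
            \<open>0 powr (p - 1)\<close> is \<open>0\<close>.\<close>
          then have "t powr (p - 1) = 0 \<or> t \<notin> {0..c}" using elim by auto
          then show ?thesis by auto
        qed
      qed
    qed
    finally show ?thesis .
  qed
  show ?thesis
  proof (cases "a = \<infinity>")
    case True
    let ?X = "\<integral>\<^sup>+t. ennreal (p * t powr (p - 1)) * of_bool (0 < t \<and> ennreal t < a) \<partial>lborel"
    \<comment> \<open>The \<open>p\<close>-th root of \<open>y\<close> is taken as \<open>c\<close>,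
      so that \<open>c powr p = y\<close>.\<close>
    have le: "ennreal y \<le> ?X" if "y \<ge> 0" for y
      using fin[of "y powr (1 / p)"] True assms that by (simp add: powr_powr)
    have "?X = \<infinity>"
    proof (cases ?X)
      case (real z)
      with le[of "z + 1"] have "ennreal (z + 1) \<le> ennreal z" by simp
      with real show ?thesis by simp
    qed simp
    then show ?thesis by simp
  next
    case False
    then show ?thesis using fin[of "enn2real a"]
      by (simp add: ennreal_powr_def ennreal_enn2real_if)
  qed
qed

section \<open>Ball families: covering argument, weak-type bound and weighted inequality\<close>

text \<open>
  \<open>B i\<close> is a ball, \<open>E i\<close> the set of points at which it enters the maximal function (the centre
  alone for centered operators) and \<open>D i\<close> an enlargement of \<open>B i\<close>.
\<close>
locale ball_family =
  fixes I :: "'i set" and B D E :: "'i \<Rightarrow> (int ^ 'd) set" and r :: "'i \<Rightarrow> nat" and C :: nat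
  assumes finite_ball: "i \<in> I \<Longrightarrow> finite (B i)"
    and ball_nonempty: "i \<in> I \<Longrightarrow> B i \<noteq> {}"
    and finite_enlarged: "i \<in> I \<Longrightarrow> finite (D i)"
    and engulfing: "\<lbrakk>i \<in> I; j \<in> I; B i \<inter> B j \<noteq> {}; r j \<le> r i\<rbrakk> \<Longrightarrow> E j \<subseteq> D i"
    and doubling: "\<lbrakk>i \<in> I; k \<in> B i\<rbrakk> \<Longrightarrow> \<exists>j\<in>I. k \<in> E j \<and> D i \<subseteq> B j \<and> card (B j) \<le> C * card (B i)"
begin

definition maximal :: "(int ^ 'd \<Rightarrow> real) \<Rightarrow> int ^ 'd \<Rightarrow> ennreal" where
  "maximal x m = (SUP i\<in>{i \<in> I. m \<in> E i}. ennreal (average_abs x (B i)))"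

text \<open>Vitali's greedy selection: keep a ball of largest \<open>r\<close>, discard all balls
  meeting it, and recurse on the rest \<open>J1\<close>. The kept ball is nonempty, hence meets
  itself and is absent from \<open>J1\<close>, so the family shrinks strictly.\<close>

lemma disjoint_subfamily:
  assumes "finite J" "J \<subseteq> I"
  shows "\<exists>J'\<subseteq>J. disjoint_family_on B J' \<and> (\<forall>j\<in>J. \<exists>i\<in>J'. B i \<inter> B j \<noteq> {} \<and> r j \<le> r i)"
  using assms
proof (induction J rule: finite_psubset_induct)
  case (psubset J)
  show ?case
  proof (cases "J = {}")
    case False
    then have "Max (r ` J) \<in> r ` J"
      using psubset.hyps by (intro Max_in) auto
    then obtain i where "i \<in> J" "r i = Max (r ` J)"
      by auto
    then have i: "i \<in> J" "\<And>j. j \<in> J \<Longrightarrow> r j \<le> r i"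
      using psubset.hyps by auto
    define J1 where "J1 = {j \<in> J. B i \<inter> B j = {}}"
    have "i \<notin> J1" using ball_nonempty i psubset.prems by (auto simp: J1_def)
    then have "J1 \<subset> J" using i by (auto simp: J1_def)
    then obtain J' where J': "J' \<subseteq> J1" "disjoint_family_on B J'"
        "\<forall>j\<in>J1. \<exists>i\<in>J'. B i \<inter> B j \<noteq> {} \<and> r j \<le> r i"
      using psubset.IH[of J1] psubset.prems by blast
    have "disjoint_family_on B (insert i J')"
      using J' by (auto simp: disjoint_family_on_def J1_def)
    moreover have "\<exists>l\<in>insert i J'. B l \<inter> B j \<noteq> {} \<and> r j \<le> r l" if "j \<in> J" for j
      using that J'(3) i(2) by (cases "j \<in> J1") (auto simp: J1_def)
    moreover have "insert i J' \<subseteq> J" using J'(1) i(1) by (auto simp: J1_def)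
    ultimately show ?thesis by blast
  qed (simp add: disjoint_family_on_def)
qed

text \<open>By \<open>doubling\<close>, \<open>D i\<close> lies in a ball entering the maximal
  function at \<open>k\<close> and at most \<open>C\<close> times as large as \<open>B i\<close>.
  The bound holds at every \<open>k\<close> in \<open>B i\<close>, so it can be inserted separately
  into each term of a sum over \<open>B i\<close>.\<close>

lemma sum_enlarged_le_maximal:
  assumes "i \<in> I" "k \<in> B i" "\<And>k. \<phi> k \<ge> 0"
  shows "ennreal (\<Sum>m\<in>D i. \<phi> m) \<le> of_nat C * of_nat (card (B i)) * maximal \<phi> k"
proof -
  obtain j where j: "j \<in> I" "k \<in> E j" "D i \<subseteq> B j" "card (B j) \<le> C * card (B i)"
    using doubling assms by blast
  have "card (B j) > 0"
    using finite_ball[OF j(1)] ball_nonempty[OF j(1)] by (simp add: card_gt_0_iff)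
  have "(\<Sum>m\<in>D i. \<phi> m) \<le> (\<Sum>m\<in>B j. \<phi> m)"
    using j finite_ball assms by (intro sum_mono2) auto
  also have "\<dots> = real (card (B j)) * average_abs \<phi> (B j)"
    using \<open>card (B j) > 0\<close> assms by (simp add: average_abs_def)
  also have "\<dots> \<le> real (C * card (B i)) * average_abs \<phi> (B j)"
    using j(4) by (intro mult_right_mono) (auto simp: average_abs_def sum_nonneg simp del: of_nat_mult)
  finally have "ennreal (\<Sum>m\<in>D i. \<phi> m) \<le> ennreal (real (C * card (B i)) * average_abs \<phi> (B j))"
    by (rule ennreal_leI)
  also have "\<dots> = of_nat C * of_nat (card (B i)) * ennreal (average_abs \<phi> (B j))"
    by (simp add: ennreal_mult' ennreal_of_nat_eq_real_of_nat)
  also have "\<dots> \<le> of_nat C * of_nat (card (B i)) * maximal \<phi> k"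
    using j by (intro mult_left_mono) (auto simp: maximal_def intro!: SUP_upper)
  finally show ?thesis .
qed

text \<open>Values \<open>\<bar>x k\<bar> \<le> t / 2\<close> contribute at most half of
  \<open>t * card (B i)\<close> to the sum over \<open>B i\<close>; the larger values therefore
  supply the other half, whence the factor \<open>2\<close>.\<close>

lemma weak_type_ball:
  assumes "i \<in> I" "t > 0" "t < average_abs x (B i)" "\<And>k. \<phi> k \<ge> 0"
  shows "ennreal t * ennreal (\<Sum>m\<in>D i. \<phi> m)
    \<le> (\<Sum>k\<in>B i. of_nat (2 * C) * ennreal \<bar>x k\<bar> * of_bool (t < 2 * \<bar>x k\<bar>) * maximal \<phi> k)"
proof -
  define n where "n = card (B i)"
  define y where "y k = \<bar>x k\<bar> * of_bool (t < 2 * \<bar>x k\<bar>)" for k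
  have y: "y k \<ge> 0" for k by (simp add: y_def)
  have y_eq: "ennreal (y k) = ennreal \<bar>x k\<bar> * of_bool (t < 2 * \<bar>x k\<bar>)" for k
    by (auto simp: y_def)
  have n: "n > 0"
    using finite_ball ball_nonempty assms(1) by (simp add: card_gt_0_iff n_def)
  have "t * n < (\<Sum>k\<in>B i. \<bar>x k\<bar>)"
    using assms n by (simp add: average_abs_def n_def field_simps)
  also have "\<dots> \<le> (\<Sum>k\<in>B i. y k + t / 2)"
    using assms(2) by (intro sum_mono) (auto simp: y_def)
  also have "\<dots> = (\<Sum>k\<in>B i. y k) + n * t / 2"
    by (simp add: sum.distrib n_def)
  finally have "t * n \<le> 2 * (\<Sum>k\<in>B i. y k)" by (simp add: field_simps)
  then have "ennreal (t * n) \<le> ennreal (2 * (\<Sum>k\<in>B i. y k))" by (rule ennreal_leI)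
  then have le: "of_nat n * ennreal t \<le> 2 * (\<Sum>k\<in>B i. ennreal (y k))"
    using assms(2) y
    by (simp add: ennreal_mult ennreal_of_nat_eq_real_of_nat sum_nonneg mult.commute)
  \<comment> \<open>Both sides carry the factor \<open>n\<close>, positive and finite, which is
    cancelled at the end; this avoids division in \<open>ennreal\<close>.\<close>
  have "of_nat n * (ennreal t * ennreal (\<Sum>m\<in>D i. \<phi> m))
      \<le> 2 * (\<Sum>k\<in>B i. ennreal (y k)) * ennreal (\<Sum>m\<in>D i. \<phi> m)"
    using mult_right_mono[OF le] by (simp add: mult.assoc)
  also have "\<dots> = (\<Sum>k\<in>B i. 2 * ennreal (y k) * ennreal (\<Sum>m\<in>D i. \<phi> m))"
    by (simp add: sum_distrib_left sum_distrib_right)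
  also have "\<dots> \<le> (\<Sum>k\<in>B i. 2 * ennreal (y k) * (of_nat C * of_nat n * maximal \<phi> k))"
    using sum_enlarged_le_maximal[OF assms(1) _ assms(4)]
    by (intro sum_mono mult_left_mono) (auto simp: n_def)
  also have "\<dots> = of_nat n * (\<Sum>k\<in>B i. of_nat (2 * C) * ennreal (y k) * maximal \<phi> k)"
    by (simp add: sum_distrib_left mult_ac)
  also have "\<dots> = of_nat n * (\<Sum>k\<in>B i. of_nat (2 * C) * ennreal \<bar>x k\<bar> * of_bool (t < 2 * \<bar>x k\<bar>) * maximal \<phi> k)"
    by (simp only: y_eq mult.assoc)
  finally show ?thesis
    by (subst (asm) ennreal_mult_le_mult_iff) (use n in auto)
qed

text \<open>Each point of \<open>F\<close> selects a ball of average above \<open>t\<close>. The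
  enlargements of a disjoint subfamily cover \<open>F\<close> by \<open>engulfing\<close>, and the
  bounds of \<open>weak_type_ball\<close> are summed over that subfamily.\<close>

lemma weak_type:
  assumes "finite F" "t > 0" "\<And>m. m \<in> F \<Longrightarrow> ennreal t < maximal x m" "\<And>k. \<phi> k \<ge> 0"
  shows "ennreal t * (\<Sum>m\<in>F. ennreal (\<phi> m))
    \<le> (\<integral>\<^sup>+k. of_nat (2 * C) * ennreal \<bar>x k\<bar> * of_bool (t < 2 * \<bar>x k\<bar>) * maximal \<phi> k \<partial>count_space UNIV)"
    (is "_ \<le> (\<integral>\<^sup>+k. ?g k \<partial>count_space UNIV)")
proof -
  have "\<exists>i. i \<in> I \<and> m \<in> E i \<and> t < average_abs x (B i)" if "m \<in> F" for m
    using assms(3)[OF that] \<open>t > 0\<close> by (auto simp: maximal_def less_SUP_iff ennreal_less_iff)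
  then obtain b where b: "\<And>m. m \<in> F \<Longrightarrow> b m \<in> I" "\<And>m. m \<in> F \<Longrightarrow> m \<in> E (b m)"
      "\<And>m. m \<in> F \<Longrightarrow> t < average_abs x (B (b m))"
    by metis
  obtain J where J: "J \<subseteq> b ` F" "disjoint_family_on B J"
      "\<And>j. j \<in> b ` F \<Longrightarrow> \<exists>i\<in>J. B i \<inter> B j \<noteq> {} \<and> r j \<le> r i"
    using disjoint_subfamily[of "b ` F"] assms(1) b(1) by blast
  have finJ: "finite J" using J(1) assms(1) by (rule_tac finite_subset) auto
  have JI: "i \<in> I" if "i \<in> J" for i using that J(1) b(1) by blast
  have "F \<subseteq> (\<Union>i\<in>J. D i)"
  proof
    fix m assume m: "m \<in> F"
    then obtain i where i: "i \<in> J" "B i \<inter> B (b m) \<noteq> {}" "r (b m) \<le> r i"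
      using J(3) by blast
    then have "E (b m) \<subseteq> D i" using engulfing JI b(1) m by blast
    then show "m \<in> (\<Union>i\<in>J. D i)" using b(2) m i(1) by blast
  qed
  then have "(\<Sum>m\<in>F. \<phi> m) \<le> (\<Sum>m\<in>(\<Union>i\<in>J. D i). \<phi> m)"
    using finJ finite_enlarged JI assms(4) by (intro sum_mono2) auto
  also have "\<dots> \<le> (\<Sum>i\<in>J. \<Sum>m\<in>D i. \<phi> m)"
    using finJ finite_enlarged JI assms(4) by (intro sum_UNION_le) auto
  finally have "ennreal (\<Sum>m\<in>F. \<phi> m) \<le> ennreal (\<Sum>i\<in>J. \<Sum>m\<in>D i. \<phi> m)"
    by (rule ennreal_leI)
  then have "ennreal t * (\<Sum>m\<in>F. ennreal (\<phi> m)) \<le> ennreal t * (\<Sum>i\<in>J. ennreal (\<Sum>m\<in>D i. \<phi> m))"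
    using assms(4) by (intro mult_left_mono) (simp_all add: sum_nonneg)
  also have "\<dots> \<le> (\<Sum>i\<in>J. \<Sum>k\<in>B i. ?g k)"
    unfolding sum_distrib_left
    using J(1) JI b(3) assms by (intro sum_mono weak_type_ball) auto
  \<comment> \<open>Disjointness ensures that no point is counted twice, so the number of balls does
    not enter the constant.\<close>
  also have "\<dots> = (\<Sum>k\<in>(\<Union>i\<in>J. B i). ?g k)"
    using finJ finite_ball JI J(2) by (intro sum.UNION_disjoint[symmetric]) (auto simp: disjoint_family_on_def)
  also have "\<dots> = (\<integral>\<^sup>+k. ?g k \<partial>count_space (\<Union>i\<in>J. B i))"
    using finJ finite_ball JI by (intro nn_integral_count_space_finite[symmetric]) auto
  also have "\<dots> \<le> (\<integral>\<^sup>+k. ?g k \<partial>count_space UNIV)"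
    by (auto simp: nn_integral_count_space_indicator intro!: nn_integral_mono split: split_indicator)
  finally show ?thesis .
qed

text \<open>Layer cake on the left, \<open>weak_type\<close> at each level \<open>t\<close>, then
  Tonelli. The constant comes from integrating \<open>t powr (p - 2)\<close> up to
  \<open>2 * \<bar>x k\<bar>\<close>, where the truncation cuts off.\<close>

theorem fefferman_stein:
  assumes "1 < p" "\<And>k. \<phi> k \<ge> 0"
  shows "(\<Sum>\<^sub>\<infinity>k. ennreal_powr (maximal x k) p * ennreal (\<phi> k))
    \<le> ennreal (2 * real C * p * 2 powr (p - 1) / (p - 1)) * (\<Sum>\<^sub>\<infinity>k. ennreal (\<bar>x k\<bar> powr p) * maximal \<phi> k)"
    (is "_ \<le> ennreal ?K * _")
proof -
  let ?g = "\<lambda>t k. of_nat (2 * C) * ennreal \<bar>x k\<bar> * of_bool (t < 2 * \<bar>x k\<bar>) * maximal \<phi> k"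
  \<comment> \<open>The exponent drops from \<open>p - 1\<close> to \<open>p - 2\<close> because the
    weak-type bound uses up one factor \<open>t\<close>.\<close>
  let ?h = "\<lambda>t k. ennreal (p * t powr (p - 2)) * of_bool (0 < t) * ?g t k"
  have inner: "(\<integral>\<^sup>+t. ?h t k \<partial>lborel) \<le> ennreal ?K * (ennreal (\<bar>x k\<bar> powr p) * maximal \<phi> k)" for k
  proof -
    have "(\<integral>\<^sup>+t. ?h t k \<partial>lborel)
        \<le> (\<integral>\<^sup>+t. (ennreal p * of_nat (2 * C) * ennreal \<bar>x k\<bar> * maximal \<phi> k)
              * (ennreal (t powr (p - 2)) * indicator {0..2 * \<bar>x k\<bar>} t) \<partial>lborel)"
      using assms(1) by (intro nn_integral_mono) (auto simp: ennreal_mult mult_ac split: split_indicator)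
    also have "\<dots> = (ennreal p * of_nat (2 * C) * ennreal \<bar>x k\<bar> * maximal \<phi> k)
        * ennreal ((2 * \<bar>x k\<bar>) powr (p - 1) / (p - 1))"
      \<comment> \<open>Here \<open>p > 1\<close> enters: it gives \<open>p - 2 > -1\<close>, so the
        integral converges at \<open>0\<close>.\<close>
      using nn_integral_powr_from_0[of "p - 2" "2 * \<bar>x k\<bar>"] assms(1) by (subst nn_integral_cmult) auto
    also have "\<dots> = ennreal (p * (2 * C) * \<bar>x k\<bar> * ((2 * \<bar>x k\<bar>) powr (p - 1) / (p - 1))) * maximal \<phi> k"
      unfolding ennreal_of_nat_eq_real_of_nat mult.assoc mult.commute[of "maximal \<phi> k"]
      using assms(1) by (simp add: ennreal_mult'[symmetric] mult.assoc[symmetric] del: of_nat_mult)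
    also have "p * (2 * C) * \<bar>x k\<bar> * ((2 * \<bar>x k\<bar>) powr (p - 1) / (p - 1)) = ?K * \<bar>x k\<bar> powr p"
      using powr_add[of "\<bar>x k\<bar>" 1 "p - 1"] by (simp add: powr_mult)
    also have "ennreal (?K * \<bar>x k\<bar> powr p) = ennreal ?K * ennreal (\<bar>x k\<bar> powr p)"
      using assms(1) by (intro ennreal_mult) auto
    finally show ?thesis by (simp only: mult.assoc)
  qed
  have fin: "(\<Sum>m\<in>F. ennreal_powr (maximal x m) p * ennreal (\<phi> m))
      \<le> ennreal ?K * (\<Sum>\<^sub>\<infinity>k. ennreal (\<bar>x k\<bar> powr p) * maximal \<phi> k)" if F: "finite F" for F
  proof -
    let ?w = "\<lambda>t m. ennreal (p * t powr (p - 1)) * of_bool (0 < t \<and> ennreal t < maximal x m)"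
    have meas [measurable]: "(\<lambda>t. ?w t m) \<in> borel_measurable lborel" for m
      unfolding of_bool_def by measurable
    have "(\<Sum>m\<in>F. ennreal_powr (maximal x m) p * ennreal (\<phi> m))
        \<le> (\<Sum>m\<in>F. (\<integral>\<^sup>+t. ?w t m \<partial>lborel) * ennreal (\<phi> m))"
      using assms by (intro sum_mono mult_right_mono ennreal_powr_layer_cake) auto
    also have "\<dots> = (\<integral>\<^sup>+t. (\<Sum>m\<in>F. ?w t m * ennreal (\<phi> m)) \<partial>lborel)"
      by (simp add: nn_integral_sum nn_integral_multc)
    also have "\<dots> \<le> (\<integral>\<^sup>+t. (\<integral>\<^sup>+k. ?h t k \<partial>count_space UNIV) \<partial>lborel)"
    proof (rule nn_integral_mono)
      fix t :: real
      show "(\<Sum>m\<in>F. ?w t m * ennreal (\<phi> m)) \<le> (\<integral>\<^sup>+k. ?h t k \<partial>count_space UNIV)"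
      proof (cases "t > 0")
        case True
        let ?G = "{m \<in> F. ennreal t < maximal x m}"
        have "p * t powr (p - 1) = p * t powr (p - 2) * t"
          using True powr_mult_base[of t "p - 2"] by (simp add: mult.commute)
        then have weight: "ennreal (p * t powr (p - 1)) = ennreal (p * t powr (p - 2)) * ennreal t"
          using True by (simp only: ennreal_mult'')
        have "(\<Sum>m\<in>F. ?w t m * ennreal (\<phi> m)) = (\<Sum>m\<in>?G. ennreal (p * t powr (p - 1)) * ennreal (\<phi> m))"
          using F True by (intro sum.mono_neutral_cong_right) auto
        also have "\<dots> = ennreal (p * t powr (p - 2)) * (ennreal t * (\<Sum>m\<in>?G. ennreal (\<phi> m)))"
          by (simp only: weight sum_distrib_left mult.assoc)
        also have "\<dots> \<le> ennreal (p * t powr (p - 2)) * (\<integral>\<^sup>+k. ?g t k \<partial>count_space UNIV)"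
          using F True assms by (intro mult_left_mono weak_type) auto
        also have "\<dots> = (\<integral>\<^sup>+k. ?h t k \<partial>count_space UNIV)"
          using True by (simp add: nn_integral_cmult)
        finally show ?thesis .
      qed simp
    qed
    also have "\<dots> = (\<integral>\<^sup>+k. (\<integral>\<^sup>+t. ?h t k \<partial>lborel) \<partial>count_space UNIV)"
    proof (rule nn_integral_count_space_nn_integral)
      show "(\<lambda>t. ?h t k) \<in> borel_measurable lborel" for k
        unfolding of_bool_def by measurable
    qed auto
    also have "\<dots> \<le> (\<integral>\<^sup>+k. ennreal ?K * (ennreal (\<bar>x k\<bar> powr p) * maximal \<phi> k) \<partial>count_space UNIV)"
      by (intro nn_integral_mono inner)
    also have "\<dots> = ennreal ?K * (\<integral>\<^sup>+k. ennreal (\<bar>x k\<bar> powr p) * maximal \<phi> k \<partial>count_space UNIV)"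
      by (rule nn_integral_cmult) simp
    also have "\<dots> \<le> ennreal ?K * (\<Sum>\<^sub>\<infinity>k. ennreal (\<bar>x k\<bar> powr p) * maximal \<phi> k)"
      by (intro mult_left_mono nn_integral_count_space_le_infsum) auto
    finally show ?thesis .
  qed
  show ?thesis
    \<comment> \<open>A sum of nonnegative terms is the supremum of its finite partial sums, each
      bounded by \<open>fin\<close>.\<close>
    by (subst nonneg_infsum_complete) (auto intro!: SUP_least fin)
qed

end

section \<open>Geometry of cubes and half-open cubes\<close>

lemma cube_nonempty: "cube m N \<noteq> {}"
proof -
  have "m \<in> cube m N" by (simp add: mem_cube_iff)
  then show ?thesis by blast
qed

lemma half_open_cube_nonempty: "N \<ge> 1 \<Longrightarrow> half_open_cube m N \<noteq> {}"
proof -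
  assume "N \<ge> 1"
  then have "m \<in> half_open_cube m N" by (simp add: mem_half_open_cube_iff)
  then show ?thesis by blast
qed

lemma cube_subset_cube:
  assumes "\<And>i. \<bar>m $ i - k $ i\<bar> \<le> int M - int N"
  shows "cube m N \<subseteq> cube k M"
  unfolding subset_iff mem_cube_iff atLeastAtMost_iff
proof (intro allI impI)
  fix l i assume "\<forall>i. m $ i - int N \<le> l $ i \<and> l $ i \<le> m $ i + int N"
  then have "m $ i - int N \<le> l $ i \<and> l $ i \<le> m $ i + int N" ..
  with assms[of i] show "k $ i - int M \<le> l $ i \<and> l $ i \<le> k $ i + int M" by arith
qed

lemma half_open_cube_subset_half_open_cube:
  assumes "\<And>i. \<bar>m $ i - k $ i\<bar> \<le> int M - int N"
  shows "half_open_cube m N \<subseteq> half_open_cube k M"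
  unfolding subset_iff mem_half_open_cube_iff atLeastLessThan_iff
proof (intro allI impI)
  fix l i assume "\<forall>i. m $ i - int N \<le> l $ i \<and> l $ i < m $ i + int N"
  then have "m $ i - int N \<le> l $ i \<and> l $ i < m $ i + int N" ..
  with assms[of i] show "k $ i - int M \<le> l $ i \<and> l $ i < k $ i + int M" by arith
qed

lemma cube_overlap:
  assumes "cube m N \<inter> cube k M \<noteq> {}" "M \<le> N"
  shows "\<bar>k $ i - m $ i\<bar> \<le> 2 * int N"
proof -
  obtain l where "l \<in> cube m N" "l \<in> cube k M" using assms(1) by blast
  then have "l $ i \<in> {m $ i - int N .. m $ i + int N}" "l $ i \<in> {k $ i - int M .. k $ i + int M}"
    by (simp_all only: mem_cube_iff)
  with assms(2) show ?thesis by auto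
qed

text \<open>Strictness comes from the missing upper faces. It is what places the centre
  \<open>k\<close> inside \<open>half_open_cube m (2 * N)\<close>, which also lacks its upper
  faces.\<close>

lemma half_open_cube_overlap:
  assumes "half_open_cube m N \<inter> half_open_cube k M \<noteq> {}" "M \<le> N"
  shows "\<bar>k $ i - m $ i\<bar> < 2 * int N"
proof -
  obtain l where "l \<in> half_open_cube m N" "l \<in> half_open_cube k M" using assms(1) by blast
  then have "l $ i \<in> {m $ i - int N ..< m $ i + int N}" "l $ i \<in> {k $ i - int M ..< k $ i + int M}"
    by (simp_all only: mem_half_open_cube_iff)
  with assms(2) show ?thesis by auto
qed

text \<open>The side lengths satisfy \<open>6 * N + 1 \<le> 3 * (2 * N + 1)\<close>.\<close>

lemma card_cube_triple_le:
  fixes m k :: "int ^ 'd"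
  shows "card (cube k (3 * N)) \<le> 3 ^ CARD('d) * card (cube m N)"
  unfolding card_cube power_mult_distrib[symmetric] by (rule power_mono) auto

lemma card_half_open_cube_triple:
  fixes m k :: "int ^ 'd"
  shows "card (half_open_cube k (3 * N)) = 3 ^ CARD('d) * card (half_open_cube m N)"
  unfolding card_half_open_cube power_mult_distrib[symmetric] by simp

section \<open>The three operators as ball families\<close>

text \<open>Only the centre of a smaller cube has to be engulfed, so radius \<open>2 * N\<close>
  suffices; recentring at a point of the cube costs another \<open>N\<close>, giving
  \<open>3 * N\<close>. In all three interpretations goal 4 is \<open>engulfing\<close> and goal 5
  is \<open>doubling\<close>.\<close>

interpretation odd: ball_family UNIV "\<lambda>(m :: int ^ 'd, N). cube m N" "\<lambda>(m, N). cube m (2 * N)" "\<lambda>(m, N). {m}" snd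
  "3 ^ CARD('d)"
proof (unfold_locales, goal_cases)
  case (4 i j)
  obtain m N k M where ij: "i = (m, N)" "j = (k, M)" by (cases i, cases j)
  then have "\<bar>k $ l - m $ l\<bar> \<le> 2 * int N" for l
    using 4 by (intro cube_overlap) auto
  then have "k \<in> cube m (2 * N)" by (simp add: mem_cube_iff abs_le_iff algebra_simps)
  then show ?case using ij by simp
next
  case (5 i k)
  obtain m N where i: "i = (m, N)" by (cases i)
  have "k $ l \<in> {m $ l - int N .. m $ l + int N}" for l
    using 5 i by (simp only: mem_cube_iff split_conv)
  then have "cube m (2 * N) \<subseteq> cube k (3 * N)"
    by (intro cube_subset_cube) (simp add: abs_le_iff algebra_simps)
  then show ?case using i card_cube_triple_le[of k N m] by (intro bexI[of _ "(k, 3 * N)"]) auto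
qed (auto simp: finite_cube cube_nonempty)

text \<open>Radius \<open>0\<close> is excluded from the index set, since that half-open cube is
  empty.\<close>

interpretation even: ball_family "UNIV \<times> {1..}" "\<lambda>(m :: int ^ 'd, N). half_open_cube m N"
  "\<lambda>(m, N). half_open_cube m (2 * N)" "\<lambda>(m, N). {m}" snd
  "3 ^ CARD('d)"
proof (unfold_locales, goal_cases)
  case (4 i j)
  obtain m N k M where ij: "i = (m, N)" "j = (k, M)" by (cases i, cases j)
  then have "\<bar>k $ l - m $ l\<bar> < 2 * int N" for l
    using 4 by (intro half_open_cube_overlap) auto
  then have "k \<in> half_open_cube m (2 * N)"
    by (force simp: mem_half_open_cube_iff abs_less_iff algebra_simps intro: less_imp_le)
  then show ?case using ij by simp
next
  case (5 i k)
  obtain m N where i: "i = (m, N)" "N \<ge> 1" using 5 by (cases i) auto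
  have "k $ l \<in> {m $ l - int N ..< m $ l + int N}" for l
    using 5 i by (simp only: mem_half_open_cube_iff split_conv)
  then have "half_open_cube m (2 * N) \<subseteq> half_open_cube k (3 * N)"
    by (intro half_open_cube_subset_half_open_cube) (simp add: abs_le_iff algebra_simps less_imp_le)
  then show ?case using i card_half_open_cube_triple[of k N m] by (intro bexI[of _ "(k, 3 * N)"]) auto
qed (auto simp: finite_half_open_cube half_open_cube_nonempty)

text \<open>The whole smaller cube must be engulfed, which calls for radius \<open>3 * N\<close>.
  The enlargement is itself an admissible cube containing \<open>k\<close>, so no recentring is
  required.\<close>

interpretation uncentered: ball_family UNIV "\<lambda>(m :: int ^ 'd, N). cube m N" "\<lambda>(m, N). cube m (3 * N)"
  "\<lambda>(m, N). cube m N" snd "3 ^ CARD('d)"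
proof (unfold_locales, goal_cases)
  case (4 i j)
  obtain m N k M where ij: "i = (m, N)" "j = (k, M)" by (cases i, cases j)
  then have "\<bar>k $ l - m $ l\<bar> \<le> 2 * int N" for l
    using 4 by (intro cube_overlap) auto
  moreover have "2 * int N \<le> int (3 * N) - int M"
    using 4(4) ij by simp
  ultimately have "\<bar>k $ l - m $ l\<bar> \<le> int (3 * N) - int M" for l
    by (rule order.trans)
  then have "cube k M \<subseteq> cube m (3 * N)" by (rule cube_subset_cube)
  then show ?case using ij by simp
next
  case (5 i k)
  obtain m N where i: "i = (m, N)" by (cases i)
  have "cube m N \<subseteq> cube m (3 * N)" by (rule cube_subset_cube) simp
  then show ?case using i 5 card_cube_triple_le[of m N m] by (intro bexI[of _ "(m, 3 * N)"]) auto
qed (auto simp: finite_cube cube_nonempty)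

lemma maximal_odd_eq: "maximal_odd = odd.maximal"
proof (intro ext)
  fix x and m :: "int ^ 'd"
  have "{i. m \<in> (case i of (m, N :: nat) \<Rightarrow> {m})} = range (Pair m)" by auto
  then show "maximal_odd x m = odd.maximal x m"
    by (simp only: maximal_odd_def odd.maximal_def image_image split_conv UNIV_I simp_thms)
qed

lemma maximal_even_eq: "maximal_even = even.maximal"
proof (intro ext)
  fix x and m :: "int ^ 'd"
  have "{i \<in> UNIV \<times> {1..}. m \<in> (case i of (m, N :: nat) \<Rightarrow> {m})} = Pair m ` {1..}" by auto
  then show "maximal_even x m = even.maximal x m"
    by (simp only: maximal_even_def even.maximal_def image_image split_conv UNIV_I simp_thms)
qed

lemma maximal_uncentered_eq: "maximal_uncentered = uncentered.maximal"
proof (intro ext)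
  fix x and m :: "int ^ 'd"
  have "{cube k N |k N. m \<in> cube k N}
      = (\<lambda>(k, N). cube k N) ` {i. m \<in> (case i of (k, N) \<Rightarrow> cube k N)}" by force
  then show "maximal_uncentered x m = uncentered.maximal x m"
    by (simp only: maximal_uncentered_def uncentered.maximal_def image_image split_conv UNIV_I simp_thms)
qed

theorem theorem2p1:
  fixes p :: real
  assumes "1 < p"
  shows "\<exists>K::real. K > 0 \<and>
    (\<forall>(x :: int ^ 'd \<Rightarrow> real) (\<phi> :: int ^ 'd \<Rightarrow> real). (\<forall>k. \<phi> k \<ge> 0) \<longrightarrow>
      (\<Sum>\<^sub>\<infinity>k. ennreal_powr (maximal_odd x k) p * ennreal (\<phi> k))
        \<le> ennreal K * (\<Sum>\<^sub>\<infinity>k. ennreal (\<bar>x k\<bar> powr p) * maximal_odd \<phi> k) \<and>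
      (\<Sum>\<^sub>\<infinity>k. ennreal_powr (maximal_even x k) p * ennreal (\<phi> k))
        \<le> ennreal K * (\<Sum>\<^sub>\<infinity>k. ennreal (\<bar>x k\<bar> powr p) * maximal_even \<phi> k) \<and>
      (\<Sum>\<^sub>\<infinity>k. ennreal_powr (maximal_uncentered x k) p * ennreal (\<phi> k))
        \<le> ennreal K * (\<Sum>\<^sub>\<infinity>k. ennreal (\<bar>x k\<bar> powr p) * maximal_uncentered \<phi> k))"
proof (intro exI conjI allI impI)
  \<comment> \<open>All three families have this doubling constant, so one \<open>K\<close> serves
    them all.\<close>
  let ?C = "3 ^ CARD('d) :: nat"
  let ?K = "2 * real ?C * p * 2 powr (p - 1) / (p - 1)"
  show "?K > 0" using assms by simp
  fix x \<phi> :: "int ^ 'd \<Rightarrow> real" assume "\<forall>k. \<phi> k \<ge> 0"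
  then have \<phi>: "\<And>k. \<phi> k \<ge> 0" by simp
  show "(\<Sum>\<^sub>\<infinity>k. ennreal_powr (maximal_odd x k) p * ennreal (\<phi> k))
      \<le> ennreal ?K * (\<Sum>\<^sub>\<infinity>k. ennreal (\<bar>x k\<bar> powr p) * maximal_odd \<phi> k)"
    unfolding maximal_odd_eq by (rule odd.fefferman_stein[OF assms \<phi>])
  show "(\<Sum>\<^sub>\<infinity>k. ennreal_powr (maximal_even x k) p * ennreal (\<phi> k))
      \<le> ennreal ?K * (\<Sum>\<^sub>\<infinity>k. ennreal (\<bar>x k\<bar> powr p) * maximal_even \<phi> k)"
    unfolding maximal_even_eq by (rule even.fefferman_stein[OF assms \<phi>])
  show "(\<Sum>\<^sub>\<infinity>k. ennreal_powr (maximal_uncentered x k) p * ennreal (\<phi> k))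
      \<le> ennreal ?K * (\<Sum>\<^sub>\<infinity>k. ennreal (\<bar>x k\<bar> powr p) * maximal_uncentered \<phi> k)"
    unfolding maximal_uncentered_eq by (rule uncentered.fefferman_stein[OF assms \<phi>])
qed

end
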